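(* Let $V$ be a real vector space endowed with a partial order $\preceq$ making it an ordered vector space, let $X\subseteq V$ be a convex cone, let $\mathbf{C}\subseteq X\times X$ be a convex-conic symmetric preorder on $X$, and let $(\mathbb{V},\leq)$ be a Dedekind-complete Riesz space. If $H:X\to \mathbb{V}\cup\{-\infty\}$ is $\mathbf{C}$-sublinear and monotone, then $$H(x)=\sup_{Q\in D(H)}Q(x)\quad\text{for all } x\in X,$$ where $$D(H)=\{Q:X\to \mathbb{V}\cup\{-\infty\} \;:\; Q \text{ is } \mathbf{C}\text{-linear and } Q(x)\leq H(x) \text{ for all } x\in X\}.$$
   Context: All vector spaces are real. A subset $X$ of a vector space $V$ is a convex cone if $\lambda X\subseteq X$ for all $\lambda>0$ and $X+X\subseteq X$ (so $0$ need not belong to $X$). A binary relation $\mathbf{C}\subseteq X\times X$ on a convex cone $X$ (write $x\mathbf{C}y$ for $(x,y)\in\mathbf{C}$) is a convex-conic symmetric preorder if it is reflexive, transitive, symmetric, and satisfies: (i) $(\lambda x)\mathbf{C}x$ for all $x\in X$ and $\lambda>0$; (ii) for all $x,y,z\in X$, if $x\mathbf{C}y$ and $y\mathbf{C}z$, then $(x+y)\mathbf{C}z$. An ordered vector space is a vector space with a partial order compatible with addition and with multiplication by nonnegative scalars. A Riesz space is an ordered vector space that is a lattice; it is Dedekind-complete if each (nonempty) subset that is bounded from above has a supremum. The element $-\infty$ is adjoined to $\mathbb{V}$ with $-\infty\leq v$ for all $v\in\mathbb{V}$, with the usual arithmetic $v+(-\infty)=(-\infty)+v=-\infty$ for all $v\in\mathbb{V}\cup\{-\infty\}$,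 $\lambda\cdot(-\infty)=-\infty$ for $\lambda>0$, and the convention $0\cdot(-\infty)=0_{\mathbb{V}}$. The supremum is taken in $\mathbb{V}\cup\{-\infty\}$. A map $F:X\to\mathbb{V}\cup\{-\infty\}$ is positively homogeneous if $F(\lambda x)=\lambda F(x)$ for all $\lambda>0$ and $x\in X$. It is $\mathbf{C}$-sublinear (respectively $\mathbf{C}$-linear) if it is positively homogeneous and $F(x+y)\leq F(x)+F(y)$ (respectively $=$) for all $x,y\in X$ with $x\mathbf{C}y$. It is monotone if $x\preceq y$ implies $F(x)\leq F(y)$ for all $x,y\in X$. *)

theory Defs
  imports Complex_Main "HOL-Library.Lattice_Constructions" "HOL-Library.Lub_Glb"
begin

text \<open>
  A Dedekind-complete Riesz space is a type of sort
  \<open>{ordered_real_vector, conditionally_complete_lattice}\<close>.  Adjoining \<open>-\<infinity>\<close> to it is the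
  library type \<open>'b bot\<close>, with \<open>bot.Bot\<close> for \<open>-\<infinity>\<close> and the embedding \<open>bot.Value\<close>; its order has \<open>bot.Bot\<close>
  as least element.
\<close>

instantiation bot :: (plus) plus
begin

fun plus_bot :: "'a bot \<Rightarrow> 'a bot \<Rightarrow> 'a bot" where
  "plus_bot (bot.Value v) (bot.Value w) = bot.Value (v + w)"
| "plus_bot bot.Bot w = bot.Bot"
| "plus_bot v bot.Bot = bot.Bot"

instance ..

end

text \<open>
  Only nonnegative scalars are meaningful on \<open>bot.Bot\<close>; the value \<open>bot.Bot\<close> for negative scalars is
  junk that is never used.
\<close>

instantiation bot :: (real_vector) scaleR
begin

fun scaleR_bot :: "real \<Rightarrow> 'a bot \<Rightarrow> 'a bot" where
  "scaleR_bot r (bot.Value v) = bot.Value (r *\<^sub>R v)"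
| "scaleR_bot r bot.Bot = (if r = 0 then bot.Value 0 else bot.Bot)"

instance ..

end

text \<open>
  Unlike HOL-Analysis's \<open>convex_cone\<close>, the following notion does not require \<open>0\<close> to be a member.
\<close>

definition cone_convex :: "'a::real_vector set \<Rightarrow> bool" where
  "cone_convex X \<longleftrightarrow>
     (\<forall>r>0. \<forall>x\<in>X. r *\<^sub>R x \<in> X) \<and> (\<forall>x\<in>X. \<forall>y\<in>X. x + y \<in> X)"

definition convex_conic_symmetric_preorder ::
  "'a::real_vector set \<Rightarrow> ('a \<times> 'a) set \<Rightarrow> bool" where
  "convex_conic_symmetric_preorder X C \<longleftrightarrow>
     C \<subseteq> X \<times> X \<and> refl_on X C \<and> trans C \<and> sym C \<and>
     (\<forall>x\<in>X. \<forall>r>0. (r *\<^sub>R x, x) \<in> C) \<and>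
     (\<forall>x\<in>X. \<forall>y\<in>X. \<forall>z\<in>X. (x, y) \<in> C \<and> (y, z) \<in> C \<longrightarrow> (x + y, z) \<in> C)"

text \<open>
  Maps with domain \<open>X\<close> are total functions whose values outside \<open>X\<close> are irrelevant: every
  condition below constrains a map on \<open>X\<close> only.
\<close>

definition pos_homogeneous_on ::
  "'a::real_vector set \<Rightarrow> ('a \<Rightarrow> 'b::real_vector bot) \<Rightarrow> bool" where
  "pos_homogeneous_on X F \<longleftrightarrow> (\<forall>r>0. \<forall>x\<in>X. F (r *\<^sub>R x) = r *\<^sub>R F x)"

definition C_sublinear_on ::
  "'a::real_vector set \<Rightarrow> ('a \<times> 'a) set \<Rightarrow> ('a \<Rightarrow> 'b::ordered_real_vector bot) \<Rightarrow> bool" where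
  "C_sublinear_on X C F \<longleftrightarrow>
     pos_homogeneous_on X F \<and> (\<forall>x\<in>X. \<forall>y\<in>X. (x, y) \<in> C \<longrightarrow> F (x + y) \<le> F x + F y)"

definition C_linear_on ::
  "'a::real_vector set \<Rightarrow> ('a \<times> 'a) set \<Rightarrow> ('a \<Rightarrow> 'b::real_vector bot) \<Rightarrow> bool" where
  "C_linear_on X C F \<longleftrightarrow>
     pos_homogeneous_on X F \<and> (\<forall>x\<in>X. \<forall>y\<in>X. (x, y) \<in> C \<longrightarrow> F (x + y) = F x + F y)"

definition C_linear_minorants ::
  "'a::real_vector set \<Rightarrow> ('a \<times> 'a) set \<Rightarrow> ('a \<Rightarrow> 'b::ordered_real_vector bot) \<Rightarrow> ('a \<Rightarrow> 'b bot) set"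
  where
  "C_linear_minorants X C H = {Q. C_linear_on X C Q \<and> (\<forall>x\<in>X. Q x \<le> H x)}"

end

theory Submission
  imports Defs
begin

text \<open>
  The class \<open>K\<close> of a point \<open>x\<^sub>0\<close> under \<open>C\<close> is a convex cone on which \<open>H\<close> is sublinear, and the constant
  \<open>-\<infinity>\<close> is linear on every other class, so it suffices to find on \<open>K\<close> a linear minorant \<open>q\<close> of \<open>H\<close> with
  \<open>q x\<^sub>0 = H x\<^sub>0\<close>.  If \<open>H x\<^sub>0 = -\<infinity>\<close>, take \<open>q = -\<infinity>\<close>.  Otherwise let \<open>q\<close> be minimal
  (Zorn) among the sublinear minorants that agree with \<open>H\<close> at \<open>x\<^sub>0\<close>.  For \<open>y\<close> with \<open>q y\<close> finite, the map
  \<open>x \<mapsto> inf\<^bsub>s\<ge>0\<^esub> (q (x + s y) - s q y)\<close> is again a sublinear minorant of \<open>q\<close>.  For \<open>y = x\<^sub>0\<close> it agrees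
  with \<open>q\<close> at \<open>x\<^sub>0\<close>, so by minimality \<open>q (x + x\<^sub>0) = q x + q x\<^sub>0\<close>.  This in turn shows that it agrees with
  \<open>q\<close> at \<open>x\<^sub>0\<close> for every \<open>y\<close>, and minimality gives \<open>q (x + y) \<ge> q x + q y\<close>.
\<close>

section \<open>Order and arithmetic with an adjoined bottom\<close>

lemma bot_add_mono:
  fixes a b c d :: "'b::ordered_real_vector bot"
  assumes "a \<le> c" "b \<le> d"
  shows "a + b \<le> c + d"
  using assms by (cases a; cases b; cases c; cases d) (auto intro: add_mono)

lemma bot_scaleR_left_mono:
  fixes a b :: "'b::ordered_real_vector bot"
  assumes "r > 0" "a \<le> b"
  shows "r *\<^sub>R a \<le> r *\<^sub>R b"
  using assms by (cases a; cases b) (auto intro: scaleR_left_mono)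

lemma bot_scaleR_scaleR:
  fixes a :: "'b::real_vector bot"
  assumes "r > 0" "s > 0"
  shows "r *\<^sub>R s *\<^sub>R a = (r * s) *\<^sub>R a"
  using assms by (cases a) auto

lemma bot_scaleR_one: "(1::real) *\<^sub>R a = (a :: 'b::real_vector bot)"
  by (cases a) auto

lemma bot_le_scaleR_iff:
  fixes a b :: "'b::ordered_real_vector bot"
  assumes "r > 0"
  shows "a \<le> r *\<^sub>R b \<longleftrightarrow> inverse r *\<^sub>R a \<le> b"
  using assms bot_scaleR_left_mono[of "inverse r" a "r *\<^sub>R b"]
    bot_scaleR_left_mono[of r "inverse r *\<^sub>R a" b]
  by (auto simp: bot_scaleR_scaleR bot_scaleR_one)

lemma bot_scaleR_add:
  fixes a b :: "'b::real_vector bot"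
  assumes "r > 0"
  shows "r *\<^sub>R (a + b) = r *\<^sub>R a + r *\<^sub>R b"
  using assms by (cases a; cases b) (auto simp: scaleR_add_right)

lemma bot_Value_diff_le_iff:
  fixes a :: "'b::ordered_real_vector bot"
  shows "bot.Value u \<le> a + bot.Value w \<longleftrightarrow> bot.Value (u - w) \<le> a"
  by (cases a) (auto simp: algebra_simps)

lemma bot_add_commute: "a + b = b + (a :: 'b::ordered_real_vector bot)"
  by (cases a; cases b) (auto simp: add.commute)

text \<open>Only meaningful for nonempty sets.\<close>

definition bot_Inf :: "'b::conditionally_complete_lattice bot set \<Rightarrow> 'b bot" where
  "bot_Inf A = (if \<exists>v. \<forall>a\<in>A. bot.Value v \<le> a then bot.Value (Inf {w. bot.Value w \<in> A}) else bot.Bot)"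

lemma bot_Inf_lower:
  assumes "a \<in> A"
  shows "bot_Inf A \<le> a"
proof (cases "\<exists>v. \<forall>a\<in>A. bot.Value v \<le> a")
  case True
  then obtain v where v: "\<forall>a\<in>A. bot.Value v \<le> a" by blast
  then obtain w where w: "a = bot.Value w" using assms by (cases a) auto
  have "bdd_below {w. bot.Value w \<in> A}" using v by (auto intro!: bdd_belowI[of _ v])
  then have "Inf {w. bot.Value w \<in> A} \<le> w" using assms w by (auto intro: cInf_lower)
  with True w show ?thesis by (simp add: bot_Inf_def)
next
  case False
  then have "bot_Inf A = bot.Bot" unfolding bot_Inf_def by (rule if_not_P)
  then show ?thesis by simp
qed

lemma bot_Inf_greatest:
  assumes "A \<noteq> {}" "\<And>a. a \<in> A \<Longrightarrow> c \<le> a"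
  shows "c \<le> bot_Inf A"
proof (cases c)
  case (Value u)
  have ne: "{w. bot.Value w \<in> A} \<noteq> {}"
  proof -
    from assms(1) obtain a where "a \<in> A" by blast
    with assms(2)[of a] Value show ?thesis by (cases a) auto
  qed
  have "u \<le> Inf {w. bot.Value w \<in> A}"
    using ne assms(2) Value by (intro cInf_greatest) fastforce+
  moreover have "\<exists>v. \<forall>a\<in>A. bot.Value v \<le> a" using assms(2) Value by blast
  ultimately show ?thesis using Value by (simp add: bot_Inf_def)
qed simp

text \<open>The two infima are introduced one at a time. For a finite \<open>c\<close>, all of
  \<open>B\<close> is finite, so each \<open>w\<close> from \<open>B\<close> can be subtracted to
  bound \<open>A\<close>; the infimum of \<open>A\<close> is then finite and can be subtracted in
  turn to bound \<open>B\<close>.\<close>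

lemma bot_Inf_add_greatest:
  fixes A B :: "'b::{ordered_real_vector, conditionally_complete_lattice} bot set"
  assumes "A \<noteq> {}" "B \<noteq> {}" and le: "\<And>a b. a \<in> A \<Longrightarrow> b \<in> B \<Longrightarrow> c \<le> a + b"
  shows "c \<le> bot_Inf A + bot_Inf B"
proof (cases c)
  case (Value u)
  have A: "bot.Value (u - w) \<le> bot_Inf A" if "bot.Value w \<in> B" for w
    using assms(1)
  proof (rule bot_Inf_greatest)
    fix a assume "a \<in> A"
    from le[OF this that] show "bot.Value (u - w) \<le> a" by (simp add: Value bot_Value_diff_le_iff)
  qed
  have B: "\<exists>w. b = bot.Value w" if "b \<in> B" for b
  proof -
    from assms(1) obtain a where "a \<in> A" by blast
    from le[OF this that] Value show ?thesis by (cases a; cases b) auto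
  qed
  from assms(2) B obtain w where "bot.Value w \<in> B" by blast
  with A[of w] obtain \<alpha> where \<alpha>: "bot_Inf A = bot.Value \<alpha>" by (cases "bot_Inf A") auto
  have "bot.Value (u - \<alpha>) \<le> bot_Inf B"
    using assms(2)
  proof (rule bot_Inf_greatest)
    fix b assume b: "b \<in> B"
    with B obtain w where w: "b = bot.Value w" by blast
    with A[of w] b \<alpha> show "bot.Value (u - \<alpha>) \<le> b" by (simp add: algebra_simps)
  qed
  then show ?thesis
    by (cases "bot_Inf B") (auto simp: Value \<alpha> algebra_simps)
qed simp

section \<open>Sublinear maps on a cone\<close>

text \<open>One inequality for homogeneity suffices: used with \<open>inverse r\<close> at the point
  \<open>r *\<^sub>R x\<close>, it yields the other.\<close>

lemma C_sublinear_onI: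
  fixes q :: "'a::real_vector \<Rightarrow> 'b::ordered_real_vector bot"
  assumes K: "cone_convex K"
    and hom: "\<And>r x. r > 0 \<Longrightarrow> x \<in> K \<Longrightarrow> q (r *\<^sub>R x) \<le> r *\<^sub>R q x"
    and sub: "\<And>x y. x \<in> K \<Longrightarrow> y \<in> K \<Longrightarrow> q (x + y) \<le> q x + q y"
  shows "C_sublinear_on K (K \<times> K) q"
proof -
  have "r *\<^sub>R q x \<le> q (r *\<^sub>R x)" if "r > 0" "x \<in> K" for r x
    using hom[of "inverse r" "r *\<^sub>R x"] K that
    by (simp add: cone_convex_def bot_le_scaleR_iff)
  with hom sub show ?thesis
    by (auto simp: C_sublinear_on_def pos_homogeneous_on_def intro!: antisym)
qed

text \<open>Each scaled term, and each sum of two terms, dominates some term of the target infimum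
  and hence the infimum itself. This serves both for shifts, indexed by a real, and for chains,
  indexed by their own members.\<close>

lemma C_sublinear_on_bot_Inf:
  fixes F :: "'i \<Rightarrow> 'a::real_vector \<Rightarrow> 'b::{ordered_real_vector, conditionally_complete_lattice} bot"
  assumes K: "cone_convex K" and I: "I \<noteq> {}"
    and hom: "\<And>i r x. i \<in> I \<Longrightarrow> r > 0 \<Longrightarrow> x \<in> K \<Longrightarrow> \<exists>j\<in>I. F j (r *\<^sub>R x) \<le> r *\<^sub>R F i x"
    and sub: "\<And>i j x y. i \<in> I \<Longrightarrow> j \<in> I \<Longrightarrow> x \<in> K \<Longrightarrow> y \<in> K \<Longrightarrow>
      \<exists>k\<in>I. F k (x + y) \<le> F i x + F j y"
  shows "C_sublinear_on K (K \<times> K) (\<lambda>x. bot_Inf ((\<lambda>i. F i x) ` I))"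
proof (rule C_sublinear_onI[OF K])
  have lower: "bot_Inf ((\<lambda>i. F i x) ` I) \<le> c" if "\<exists>j\<in>I. F j x \<le> c" for x c
    using that by (meson bot_Inf_lower imageI order_trans)
  show "bot_Inf ((\<lambda>i. F i (r *\<^sub>R x)) ` I) \<le> r *\<^sub>R bot_Inf ((\<lambda>i. F i x) ` I)"
    if "r > 0" "x \<in> K" for r x
    unfolding bot_le_scaleR_iff[OF \<open>r > 0\<close>]
    using I lower[OF hom[OF _ that]] by (intro bot_Inf_greatest) (auto simp: bot_le_scaleR_iff[OF \<open>r > 0\<close>, symmetric])
  show "bot_Inf ((\<lambda>i. F i (x + y)) ` I) \<le> bot_Inf ((\<lambda>i. F i x) ` I) + bot_Inf ((\<lambda>i. F i y) ` I)"
    if "x \<in> K" "y \<in> K" for x y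
    using I lower[OF sub[OF _ _ that]] by (intro bot_Inf_add_greatest) auto
qed

section \<open>Shifting a sublinear map along a direction\<close>

context
  fixes K :: "'a::real_vector set"
    and q :: "'a \<Rightarrow> 'b::{ordered_real_vector, conditionally_complete_lattice} bot"
  assumes K: "cone_convex K" and q: "C_sublinear_on K (K \<times> K) q"
begin

lemma cone_add_scaleR:
  assumes "x \<in> K" "y \<in> K" "s \<ge> 0"
  shows "x + s *\<^sub>R y \<in> K"
  \<comment> \<open>For \<open>s = 0\<close> the point is \<open>x\<close>; the cone is closed under
    positive factors only and may lack 0.\<close>
  using K assms unfolding cone_convex_def by (cases "s = 0") auto

text \<open>The infimum of the overview, with a vector \<open>w\<close> in place of
  \<open>q y\<close>: only finite values are ever subtracted.\<close>

definition shift :: "'a \<Rightarrow> 'b \<Rightarrow> 'a \<Rightarrow> 'b bot" where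
  "shift y w x = bot_Inf ((\<lambda>s. q (x + s *\<^sub>R y) + bot.Value (- (s *\<^sub>R w))) ` {0..})"

lemma shift_le:
  assumes "s \<ge> 0"
  shows "shift y w x \<le> q (x + s *\<^sub>R y) + bot.Value (- (s *\<^sub>R w))"
  unfolding shift_def using assms by (intro bot_Inf_lower) auto

lemma shift_le_self: "shift y w x \<le> q x"
  using shift_le[of 0 y w x] by (cases "q x") auto

text \<open>Scaling the point by \<open>r\<close> turns the parameter \<open>s\<close> into
  \<open>r * s\<close>, and adding points adds the parameters.\<close>

lemma sublinear_shift:
  assumes y: "y \<in> K"
  shows "C_sublinear_on K (K \<times> K) (shift y w)"
  unfolding shift_def
proof (rule C_sublinear_on_bot_Inf[OF K])
  fix s r :: real and x assume s: "s \<in> {0..}" and r: "r > 0" and x: "x \<in> K"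
  have "q (r *\<^sub>R x + (r * s) *\<^sub>R y) = r *\<^sub>R q (x + s *\<^sub>R y)"
    using q r cone_add_scaleR[OF x y] s
    by (simp add: C_sublinear_on_def pos_homogeneous_on_def flip: scaleR_scaleR scaleR_add_right)
  then have "q (r *\<^sub>R x + (r * s) *\<^sub>R y) + bot.Value (- ((r * s) *\<^sub>R w)) =
      r *\<^sub>R (q (x + s *\<^sub>R y) + bot.Value (- (s *\<^sub>R w)))"
    using r by (simp add: bot_scaleR_add)
  then show "\<exists>t\<in>{0..}. q (r *\<^sub>R x + t *\<^sub>R y) + bot.Value (- (t *\<^sub>R w)) \<le>
      r *\<^sub>R (q (x + s *\<^sub>R y) + bot.Value (- (s *\<^sub>R w)))"
    using r s by (intro bexI[of _ "r * s"]) auto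
next
  fix s t :: real and x z assume s: "s \<in> {0..}" and t: "t \<in> {0..}" and x: "x \<in> K" and z: "z \<in> K"
  have "q ((x + s *\<^sub>R y) + (z + t *\<^sub>R y)) \<le> q (x + s *\<^sub>R y) + q (z + t *\<^sub>R y)"
    using q cone_add_scaleR[OF x y] cone_add_scaleR[OF z y] s t by (auto simp: C_sublinear_on_def)
  then have "q (x + z + (s + t) *\<^sub>R y) \<le> q (x + s *\<^sub>R y) + q (z + t *\<^sub>R y)"
    by (simp add: algebra_simps)
  then have "q (x + z + (s + t) *\<^sub>R y) + bot.Value (- ((s + t) *\<^sub>R w)) \<le>
      (q (x + s *\<^sub>R y) + q (z + t *\<^sub>R y)) + bot.Value (- ((s + t) *\<^sub>R w))"
    by (rule bot_add_mono) simp
  also have "\<dots> = (q (x + s *\<^sub>R y) + bot.Value (- (s *\<^sub>R w))) + (q (z + t *\<^sub>R y) + bot.Value (- (t *\<^sub>R w)))"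
    by (cases "q (x + s *\<^sub>R y)"; cases "q (z + t *\<^sub>R y)") (auto simp: algebra_simps)
  finally show "\<exists>k\<in>{0..}. q (x + z + k *\<^sub>R y) + bot.Value (- (k *\<^sub>R w)) \<le>
      (q (x + s *\<^sub>R y) + bot.Value (- (s *\<^sub>R w))) + (q (z + t *\<^sub>R y) + bot.Value (- (t *\<^sub>R w)))"
    using s t by (intro bexI[of _ "s + t"]) auto
qed simp

lemma minimal_imp_C_linear:
  assumes x0: "x0 \<in> K" and v: "q x0 = bot.Value v"
    and min: "\<And>q'. C_sublinear_on K (K \<times> K) q' \<Longrightarrow> q' \<le> q \<Longrightarrow> q' x0 = q x0 \<Longrightarrow> q' = q"
  shows "C_linear_on K (K \<times> K) q"
proof -
  have hom: "q (r *\<^sub>R x) = r *\<^sub>R q x" if "r > 0" "x \<in> K" for r x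
    using q that by (simp add: C_sublinear_on_def pos_homogeneous_on_def)
  \<comment> \<open>The bounds for all \<open>s\<close> make \<open>shift y w\<close> agree with
    \<open>q\<close> at \<open>x0\<close>, so minimality makes the two maps equal. The term
    \<open>s = 1\<close> of the infimum then gives the claim.\<close>
  have add_le: "q x + bot.Value w \<le> q (x + y)"
    if y: "y \<in> K" and *: "\<And>s. s \<ge> 0 \<Longrightarrow> bot.Value (v + s *\<^sub>R w) \<le> q (x0 + s *\<^sub>R y)" for x y w
  proof -
    have "bot.Value v \<le> shift y w x0"
      unfolding shift_def
    proof (rule bot_Inf_greatest)
      fix a assume "a \<in> (\<lambda>s. q (x0 + s *\<^sub>R y) + bot.Value (- (s *\<^sub>R w))) ` {0..}"
      then show "bot.Value v \<le> a" using * by (auto simp: bot_Value_diff_le_iff)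
    qed simp
    then have "shift y w = q"
      using shift_le_self[of y w x0]
      by (intro min sublinear_shift y le_funI shift_le_self) (simp add: v antisym)
    with shift_le[of 1 y w x] have "q x \<le> q (x + y) + bot.Value (- w)" by simp
    from bot_add_mono[OF this order_refl, of "bot.Value w"]
    show ?thesis by (cases "q (x + y)") auto
  qed
  have x0_le: "q x + bot.Value v \<le> q (x + x0)" for x
  proof (rule add_le[OF x0])
    fix s :: real assume "s \<ge> 0"
    then show "bot.Value (v + s *\<^sub>R v) \<le> q (x0 + s *\<^sub>R x0)"
      \<comment> \<open>On the ray through \<open>x0\<close> the bound is an equality, as
        \<open>x0 + s *\<^sub>R x0\<close> is \<open>(1 + s) *\<^sub>R x0\<close>.\<close>
      using hom[of "1 + s" x0] x0 v by (simp add: scaleR_add_left)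
  qed
  have "q x + q y \<le> q (x + y)" if "x \<in> K" "y \<in> K" for x y
  proof (cases "q y")
    case (Value w)
    have "bot.Value (v + s *\<^sub>R w) \<le> q (x0 + s *\<^sub>R y)" if "s \<ge> 0" for s
      \<comment> \<open>For \<open>s > 0\<close>, \<open>x0_le\<close> at
        \<open>s *\<^sub>R y\<close> and homogeneity give the bound; \<open>s = 0\<close> is apart
        since \<open>hom\<close> needs a positive factor.\<close>
      using x0_le[of "s *\<^sub>R y"] hom[OF _ \<open>y \<in> K\<close>, of s] that Value v
      by (cases "s = 0") (auto simp: add.commute)
    from add_le[OF \<open>y \<in> K\<close> this] Value show ?thesis by simp
  qed (simp add: bot_add_commute)
  with q show ?thesis
    by (auto simp: C_linear_on_def C_sublinear_on_def intro: antisym)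
qed

end

text \<open>A Hahn-Banach theorem on a cone. Zorn applies because all candidates share the finite
  value at \<open>x0\<close>, which the infimum of a nonempty chain keeps.\<close>

lemma sublinear_attained:
  fixes p :: "'a::real_vector \<Rightarrow> 'b::{ordered_real_vector, conditionally_complete_lattice} bot"
  assumes K: "cone_convex K" and p: "C_sublinear_on K (K \<times> K) p"
    and x0: "x0 \<in> K" and v: "p x0 = bot.Value v"
  obtains q where "C_linear_on K (K \<times> K) q" "q \<le> p" "q x0 = p x0"
proof -
  \<comment> \<open>Maps are compared on the whole type, not just on \<open>K\<close>, so that the
    order is antisymmetric.\<close>
  define S where "S = {q. C_sublinear_on K (K \<times> K) q \<and> q \<le> p \<and> q x0 = p x0}"
  have "\<exists>m\<in>S. \<forall>q\<in>S. q \<le> m \<longrightarrow> q = m"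
  proof (rule predicate_Zorn)
    \<comment> \<open>The order is reversed, so that a maximal element is a minimal map.\<close>
    show "partial_order_on S (relation_of (\<lambda>q r. r \<le> q) S)"
      by (rule partial_order_on_relation_ofI) auto
  next
    fix L assume "L \<in> Chains (relation_of (\<lambda>q r. r \<le> q) S)"
    then have L: "L \<subseteq> S" and chain: "\<And>q r. q \<in> L \<Longrightarrow> r \<in> L \<Longrightarrow> q \<le> r \<or> r \<le> q"
      by (auto simp: Chains_def relation_of_def)
    show "\<exists>u\<in>S. \<forall>q\<in>L. u \<le> q"
    proof (cases "L = {}")
      case True
      with p show ?thesis by (auto simp: S_def)
    next
      case False
      define u where "u x = bot_Inf ((\<lambda>q. q x) ` L)" for x
      have u_le: "u \<le> q" if "q \<in> L" for q
        unfolding u_def using that by (intro le_funI bot_Inf_lower) auto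
      have "C_sublinear_on K (K \<times> K) u"
        unfolding u_def
      proof (rule C_sublinear_on_bot_Inf[OF K False])
        show "\<exists>j\<in>L. j (r *\<^sub>R x) \<le> r *\<^sub>R q x" if "q \<in> L" "r > 0" "x \<in> K" for q r x
          using L that by (intro bexI[of _ q]) (auto simp: S_def C_sublinear_on_def pos_homogeneous_on_def)
        show "\<exists>k\<in>L. k (x + y) \<le> q x + r y" if "q \<in> L" "r \<in> L" "x \<in> K" "y \<in> K" for q r x y
        proof -
          \<comment> \<open>The smaller of the two maps serves as the common index.\<close>
          from chain[OF that(1,2)] that(1,2) obtain k where k: "k \<in> L" "k \<le> q" "k \<le> r" by blast
          have "k (x + y) \<le> k x + k y" using L k that by (auto simp: S_def C_sublinear_on_def)
          also have "\<dots> \<le> q x + r y" using k by (intro bot_add_mono) (auto dest: le_funD)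
          finally show ?thesis using k by blast
        qed
      qed
      moreover from False obtain r where r: "r \<in> L" by blast
      then have "u \<le> p" using u_le[OF r] L by (auto simp: S_def)
      moreover have "u x0 = p x0"
      proof (rule antisym)
        show "u x0 \<le> p x0" using \<open>u \<le> p\<close> by (rule le_funD)
        show "p x0 \<le> u x0" unfolding u_def using L False
          by (intro bot_Inf_greatest) (auto simp: S_def)
      qed
      ultimately show ?thesis using u_le by (auto simp: S_def)
    qed
  qed
  then obtain m where m: "m \<in> S" and min: "\<And>q. q \<in> S \<Longrightarrow> q \<le> m \<Longrightarrow> q = m" by blast
  have "C_linear_on K (K \<times> K) m"
  proof (rule minimal_imp_C_linear[OF K _ x0, of m v])
    fix q' assume "C_sublinear_on K (K \<times> K) q'" "q' \<le> m" "q' x0 = m x0"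
    with m show "q' = m" by (intro min) (auto simp: S_def)
  qed (use m v in \<open>auto simp: S_def\<close>)
  with m that show thesis by (auto simp: S_def)
qed

section \<open>Extension from one class to the whole cone\<close>

theorem corollary2:
  fixes X :: "'a::ordered_real_vector set"
    and C :: "('a \<times> 'a) set"
    and H :: "'a \<Rightarrow> 'b::{ordered_real_vector, conditionally_complete_lattice} bot"
  assumes "cone_convex X"
    and "convex_conic_symmetric_preorder X C"
    and "C_sublinear_on X C H"
    and "mono_on X H"
  shows "\<forall>x\<in>X. isLub UNIV ((\<lambda>Q. Q x) ` C_linear_minorants X C H) (H x)"
proof
  fix x0 assume x0: "x0 \<in> X"
  note C = assms(2)[unfolded convex_conic_symmetric_preorder_def]
  define K where "K = {y. (y, x0) \<in> C}"
  have CX: "y \<in> X \<and> z \<in> X" if "(y, z) \<in> C" for y z using C that by blast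
  have tr: "(a, c) \<in> C" if "(a, b) \<in> C" "(b, c) \<in> C" for a b c using C that by (meson transD)
  have sy: "(b, a) \<in> C" if "(a, b) \<in> C" for a b using C that by (meson symD)
  have scale: "(r *\<^sub>R y, y) \<in> C" if "r > 0" "y \<in> X" for r y using C that by blast
  have plus: "(y + z, w) \<in> C" if "(y, z) \<in> C" "(z, w) \<in> C" for y z w using C that CX by blast
  have x0K: "x0 \<in> K" using C x0 by (auto simp: K_def refl_on_def)
  have KX: "y \<in> X" if "y \<in> K" for y using that CX by (auto simp: K_def)
  have KC: "(y, z) \<in> C" if "y \<in> K" "z \<in> K" for y z using tr[of y x0 z] sy[of z x0] that by (simp add: K_def)
  have K_iff: "y \<in> K \<longleftrightarrow> z \<in> K" if "(y, z) \<in> C" for y z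
    unfolding K_def mem_Collect_eq using tr[OF that] tr[OF sy[OF that]] by (rule iffI[rotated])
  have K: "cone_convex K"
    unfolding cone_convex_def
  proof (intro conjI allI impI ballI)
    show "r *\<^sub>R y \<in> K" if "r > 0" "y \<in> K" for r y
      using K_iff[OF scale[OF \<open>r > 0\<close> KX]] that by simp
    show "y + z \<in> K" if "y \<in> K" "z \<in> K" for y z
      using plus[OF KC[OF that]] that by (simp add: K_def)
  qed
  have HK: "C_sublinear_on K (K \<times> K) H"
    using assms(3) KX KC by (auto simp: C_sublinear_on_def pos_homogeneous_on_def)
  obtain Q where Q: "Q \<in> C_linear_minorants X C H" "Q x0 = H x0"
  proof (cases "H x0")
    case Bot
    then show thesis
      by (intro that[of "\<lambda>_. bot.Bot"])
        (auto simp: C_linear_minorants_def C_linear_on_def pos_homogeneous_on_def)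
  next
    case (Value v)
    from sublinear_attained[OF K HK x0K Value]
    obtain q where q: "C_linear_on K (K \<times> K) q" "q \<le> H" "q x0 = H x0" .
    \<comment> \<open>Points related by \<open>C\<close> lie both in \<open>K\<close> or both
      outside it, so the two pieces never mix in a sum that matters.\<close>
    define Q where "Q y = (if y \<in> K then q y else bot.Bot)" for y
    have "Q (r *\<^sub>R y) = r *\<^sub>R Q y" if "r > 0" "y \<in> X" for r y
      using q(1) K_iff[OF scale[OF that]] that
      by (auto simp: Q_def C_linear_on_def pos_homogeneous_on_def)
    moreover have "Q (y + z) = Q y + Q z" if "(y, z) \<in> C" for y z
    proof -
      \<comment> \<open>With \<open>z\<close> as third point, the additivity axiom puts
        \<open>y + z\<close> in the class of \<open>z\<close>.\<close>
      have "(z, z) \<in> C" using tr[OF sy[OF that] that] .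
      then have "y + z \<in> K \<longleftrightarrow> z \<in> K" using plus[OF that] K_iff by blast
      then show ?thesis
        using q(1) K_iff[OF that] by (auto simp: Q_def C_linear_on_def)
    qed
    ultimately have "Q \<in> C_linear_minorants X C H"
      using q(2) by (auto simp: C_linear_minorants_def C_linear_on_def pos_homogeneous_on_def Q_def dest: le_funD)
    with q(3) x0K that show thesis by (simp add: Q_def)
  qed
  show "isLub UNIV ((\<lambda>Q. Q x0) ` C_linear_minorants X C H) (H x0)"
  proof (rule isLubI2)
    show "isUb UNIV ((\<lambda>Q. Q x0) ` C_linear_minorants X C H) (H x0)"
      using x0 by (intro isUb_UNIV_I) (auto simp: C_linear_minorants_def)
    show "H x0 <=* Collect (isUb UNIV ((\<lambda>Q. Q x0) ` C_linear_minorants X C H))"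
    proof (rule setgeI, rule ballI)
      fix b assume "b \<in> Collect (isUb UNIV ((\<lambda>Q. Q x0) ` C_linear_minorants X C H))"
      \<comment> \<open>\<open>H x0\<close> is itself the value of the minorant \<open>Q\<close> at
        \<open>x0\<close>, so every upper bound dominates it.\<close>
      with Q show "H x0 \<le> b" by (auto dest!: isUbD intro: rev_image_eqI)
    qed
  qed
qed

end
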